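(* The map $\beta$ restricts to a bijection from the set of valid marked arrays onto the set of quantile partitioned walks.
   Context: Intervals $[a,b]$ are intervals of integers; walks are simple: $v:[0,n]\to\mathbb Z$, $v(0)=0$, $v(i)-v(i-1)=\pm1$; $(c)_+=\max(c,0)$. Marked arrays. An increment array is a collection $\mathbf x=(\underline x_i)_{i=0}^{\mathcal L}$ ($\mathcal L\ge0$) of non-empty finite sequences ("rows") with entries $\pm1$; a marked array is a pair $(\mathbf x,\mathcal P)$ with $\mathcal P\in[0,\mathcal L]$. Let $u_i,d_i$ be the numbers of $+1$'s and $-1$'s in $\underline x_i$, $\sigma_{\mathbf x}=\sum_{i=0}^{\mathcal L}(u_i-d_i)$, $\mathcal T=\mathcal P+x^*_{\mathcal P}$ with $x^*_{\mathcal P}$ the final entry of $\underline x_{\mathcal P}$, and $\mathcal S=\mathcal T-\sigma_{\mathbf x}$. The marked array is valid if it has: the Bookends property (for $i\in[0,\mathcal L]$: if $i\le\min\{\mathcal P,\mathcal T\}$ the final entry of $\underline x_i$ is $1$; if $i\ge\max\{\mathcal P,\mathcal T\}$ it is $-1$) and the Crossings property ($u_{i-1}-d_i=\mathbf 1\{i\le\mathcal T\}-\mathbf 1\{i\le\mathcal S\}$ for each $i\in[0,\mathcal L+1]$, with $u_{-1}=d_{\mathcal L+1}=0$). Partitioned walks. A partitioned walk is a triple $\mathbf v=(v,(t_i)_{i=0}^{\mathcal L+1},\mathcal P)$ where $v$ is a walk of some length $n$, $0=t_0<t_1<\dots<t_{\mathcal L+1}=n$ are integers and $\mathcal P\in[0,\mathcal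 L]$. Set $\mathcal T=\mathcal P+v(t_{\mathcal P+1})-v(t_{\mathcal P+1}-1)$, $\mathcal S=\mathcal T-v(t_{\mathcal L+1})$, and $M_{\mathbf v}(j)=(j-\mathcal S)_+-(j-\mathcal T)_+$. It has the Bookends property if for $i\in[0,\mathcal L]$ with $i\le\min\{\mathcal T,\mathcal P\}$ the $t_{i+1}$-th increment of $v$ is $+1$, and for $i\in[0,\mathcal L]$ with $i\ge\max\{\mathcal T,\mathcal P\}$ the $t_{i+1}$-th increment of $v$ is $-1$. It has the Saw property if $v(t_{j+1})+v(t_j)=t_{j+1}-t_j+2M_{\mathbf v}(j)$ for each $j\in[0,\mathcal L]$. A quantile partitioned walk is a partitioned walk with both properties. The map $\beta$ sends a marked array $((\underline x_i)_{i=0}^{\mathcal L},\mathcal P)$ to the unique partitioned walk $(v,(t_i)_{i=0}^{\mathcal L+1},\mathcal P)$ (with the same $\mathcal L$, $\mathcal P$) such that $\underline x_i=(v(t_i+1)-v(t_i),\,v(t_i+2)-v(t_i+1),\dots,v(t_{i+1})-v(t_{i+1}-1))$ for every $i\in[0,\mathcal L]$. *)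

theory Defs
  imports Main
begin

section \<open>Marked arrays\<close>

text \<open>
  An increment array with rows $0,\dots,L$ is the list of its $L+1$ rows; an entry of a marked
  array is addressed by its natural-number index, while $T$, $S$ and the row index in the
  Crossings property are integers (they may be negative or exceed $L$).
\<close>

type_synonym marked_array = "int list list \<times> nat"

definition top_row :: "int list list \<Rightarrow> nat" where
  "top_row x = length x - 1"

definition increment_array :: "int list list \<Rightarrow> bool" where
  "increment_array x \<longleftrightarrow> x \<noteq> [] \<and> (\<forall>r\<in>set x. r \<noteq> [] \<and> set r \<subseteq> {1, -1})"

definition is_marked_array :: "marked_array \<Rightarrow> bool" where
  "is_marked_array = (\<lambda>(x, P). increment_array x \<and> P \<in> {0..top_row x})"

text \<open>The guard on the index implements the conventions $u_{-1} = 0$ and $d_{L+1} = 0$.\<close>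

definition row_ups :: "int list list \<Rightarrow> int \<Rightarrow> int" where
  "row_ups x i = (if i \<in> {0..int (top_row x)} then int (count_list (x ! nat i) 1) else 0)"

definition row_downs :: "int list list \<Rightarrow> int \<Rightarrow> int" where
  "row_downs x i = (if i \<in> {0..int (top_row x)} then int (count_list (x ! nat i) (-1)) else 0)"

definition array_sigma :: "int list list \<Rightarrow> int" where
  "array_sigma x = (\<Sum>i\<in>{0..int (top_row x)}. row_ups x i - row_downs x i)"

definition array_T :: "marked_array \<Rightarrow> int" where
  "array_T = (\<lambda>(x, P). int P + last (x ! P))"

definition array_S :: "marked_array \<Rightarrow> int" where
  "array_S = (\<lambda>(x, P). array_T (x, P) - array_sigma x)"

definition array_bookends :: "marked_array \<Rightarrow> bool" where
  "array_bookends = (\<lambda>(x, P). \<forall>i\<in>{0..top_row x}.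
     (int i \<le> min (int P) (array_T (x, P)) \<longrightarrow> last (x ! i) = 1) \<and>
     (int i \<ge> max (int P) (array_T (x, P)) \<longrightarrow> last (x ! i) = -1))"

definition array_crossings :: "marked_array \<Rightarrow> bool" where
  "array_crossings = (\<lambda>(x, P). \<forall>i\<in>{0..int (top_row x) + 1}.
     row_ups x (i - 1) - row_downs x i =
       of_bool (i \<le> array_T (x, P)) - of_bool (i \<le> array_S (x, P)))"

definition valid_marked_array :: "marked_array \<Rightarrow> bool" where
  "valid_marked_array m \<longleftrightarrow> is_marked_array m \<and> array_bookends m \<and> array_crossings m"

section \<open>Partitioned walks\<close>

text \<open>
  A walk $v : [0,n] \to \mathbf{Z}$ is the list of its $n+1$ values, and $(t_i)_{i=0}^{L+1}$
  is a list of length $L+2$.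
\<close>

definition is_walk :: "nat \<Rightarrow> int list \<Rightarrow> bool" where
  "is_walk n v \<longleftrightarrow> length v = n + 1 \<and> v ! 0 = 0 \<and> (\<forall>i\<in>{1..n}. v ! i - v ! (i - 1) \<in> {1, -1})"

type_synonym partitioned_walk = "int list \<times> nat list \<times> nat"

definition top_index :: "nat list \<Rightarrow> nat" where
  "top_index t = length t - 2"

definition is_partitioned_walk :: "partitioned_walk \<Rightarrow> bool" where
  "is_partitioned_walk = (\<lambda>(v, t, P). \<exists>n L. is_walk n v \<and>
     length t = L + 2 \<and> t ! 0 = 0 \<and> (\<forall>i\<in>{0..L}. t ! i < t ! (i + 1)) \<and> t ! (L + 1) = n \<and>
     P \<in> {0..L})"

text \<open>The \<open>k\<close>-th increment, for \<open>k \<ge> 1\<close>.\<close>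

definition walk_incr :: "int list \<Rightarrow> nat \<Rightarrow> int" where
  "walk_incr v k = v ! k - v ! (k - 1)"

definition walk_T :: "partitioned_walk \<Rightarrow> int" where
  "walk_T = (\<lambda>(v, t, P). int P + v ! (t ! (P + 1)) - v ! (t ! (P + 1) - 1))"

definition walk_S :: "partitioned_walk \<Rightarrow> int" where
  "walk_S = (\<lambda>(v, t, P). walk_T (v, t, P) - v ! (t ! (top_index t + 1)))"

definition walk_M :: "partitioned_walk \<Rightarrow> int \<Rightarrow> int" where
  "walk_M w j = max (j - walk_S w) 0 - max (j - walk_T w) 0"

definition walk_bookends :: "partitioned_walk \<Rightarrow> bool" where
  "walk_bookends = (\<lambda>(v, t, P). \<forall>i\<in>{0..top_index t}.
     (int i \<le> min (walk_T (v, t, P)) (int P) \<longrightarrow> walk_incr v (t ! (i + 1)) = 1) \<and>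
     (int i \<ge> max (walk_T (v, t, P)) (int P) \<longrightarrow> walk_incr v (t ! (i + 1)) = -1))"

definition walk_saw :: "partitioned_walk \<Rightarrow> bool" where
  "walk_saw = (\<lambda>(v, t, P). \<forall>j\<in>{0..top_index t}.
     v ! (t ! (j + 1)) + v ! (t ! j) =
       int (t ! (j + 1)) - int (t ! j) + 2 * walk_M (v, t, P) (int j))"

definition quantile_partitioned_walk :: "partitioned_walk \<Rightarrow> bool" where
  "quantile_partitioned_walk w \<longleftrightarrow> is_partitioned_walk w \<and> walk_bookends w \<and> walk_saw w"

section \<open>The map from marked arrays to partitioned walks\<close>

definition beta_rel :: "marked_array \<Rightarrow> partitioned_walk \<Rightarrow> bool" where
  "beta_rel = (\<lambda>(x, P) (v, t, Q). top_index t = top_row x \<and> Q = P \<and>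
     (\<forall>i\<in>{0..top_row x}. x ! i = map (\<lambda>k. v ! (k + 1) - v ! k) [t ! i..<t ! (i + 1)]))"

definition beta :: "marked_array \<Rightarrow> partitioned_walk" where
  "beta m = (THE w. is_partitioned_walk w \<and> beta_rel m w)"

text \<open>\<^term>\<open>beta\<close> is well defined: the walk in its definition exists and is unique.\<close>

lemma nth_concat_offset:
  assumes "i < length x" "j < length (x ! i)"
  shows "concat x ! (length (concat (take i x)) + j) = x ! i ! j"
proof -
  have "concat x = concat (take i x) @ x ! i @ concat (drop (Suc i) x)"
    by (metis assms(1) concat.simps(2) concat_append id_take_nth_drop)
  then show ?thesis using assms(2) by (simp add: nth_append)
qed

lemma beta_ex:
  assumes m: "is_marked_array (x, P)"
  shows "\<exists>w. is_partitioned_walk w \<and> beta_rel (x, P) w"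
proof -
  define c where "c = concat x"
  define n where "n = length c"
  define t where "t = map (\<lambda>i. length (concat (take i x))) [0..<length x + 1]"
  define v where "v = map (\<lambda>k. sum_list (take k c)) [0..<n + 1]"
  have x: "x \<noteq> []" "\<And>i. i < length x \<Longrightarrow> x ! i \<noteq> []" "set c \<subseteq> {1, -1}" "P \<le> length x - 1"
    using m by (auto simp: is_marked_array_def increment_array_def top_row_def c_def)
  have vS: "v ! (k + 1) - v ! k = c ! k" if "k < n" for k
    using that by (simp add: v_def n_def take_Suc_conv_app_nth del: upt_Suc)
  have tS: "t ! (i + 1) = t ! i + length (x ! i)" if "i < length x" for i
    using that by (simp add: t_def take_Suc_conv_app_nth del: upt_Suc)
  have t_le: "t ! i \<le> n" if "i \<le> length x" for i
  proof -
    have "c = concat (take i x) @ concat (drop i x)"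
      unfolding c_def by (metis append_take_drop_id concat_append)
    then show ?thesis using that by (simp add: t_def n_def del: upt_Suc)
  qed
  have row: "x ! i = map (\<lambda>k. v ! (k + 1) - v ! k) [t ! i..<t ! (i + 1)]" if i: "i < length x" for i
  proof (rule nth_equalityI)
    show "length (x ! i) = length (map (\<lambda>k. v ! (k + 1) - v ! k) [t ! i..<t ! (i + 1)])"
      using tS[OF i] by simp
  next
    fix j assume j: "j < length (x ! i)"
    have "t ! i + j < n" using t_le[of "i + 1"] tS[OF i] i j by simp
    moreover have "c ! (t ! i + j) = x ! i ! j"
      using nth_concat_offset[OF i j] i by (simp add: t_def c_def del: upt_Suc)
    ultimately show "x ! i ! j = map (\<lambda>k. v ! (k + 1) - v ! k) [t ! i..<t ! (i + 1)] ! j"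
      using vS[of "t ! i + j"] tS[OF i] j by simp
  qed
  have "is_walk n v"
    unfolding is_walk_def
  proof (intro conjI ballI)
    show "length v = n + 1" "v ! 0 = 0" by (simp_all add: v_def del: upt_Suc)
    fix i assume "i \<in> {1..n}"
    then have "i - 1 < n" "i - 1 + 1 = i" by auto
    then show "v ! i - v ! (i - 1) \<in> {1, -1}"
      using vS[of "i - 1"] x(3) by (metis n_def nth_mem subsetD)
  qed
  moreover have "length t = (length x - 1) + 2" using x(1) by (cases x) (simp_all add: t_def)
  moreover have "t ! 0 = 0" by (simp add: t_def del: upt_Suc)
  moreover have "\<forall>i\<in>{0..length x - 1}. t ! i < t ! (i + 1)"
  proof
    fix i assume "i \<in> {0..length x - 1}"
    then have "i < length x" using x(1) by (cases x) auto
    then show "t ! i < t ! (i + 1)" using tS x(2) by simp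
  qed
  moreover have "t ! (length x - 1 + 1) = n"
    using x(1) by (simp add: t_def n_def c_def del: upt_Suc)
  moreover have "beta_rel (x, P) (v, t, P)"
    unfolding beta_rel_def top_index_def top_row_def
    using row x(1) \<open>length t = (length x - 1) + 2\<close> by (cases x) auto
  ultimately show ?thesis
    unfolding is_partitioned_walk_def using x(4)
    by (intro exI[of _ "(v, t, P)"]) auto
qed

lemma beta_concat:
  fixes t :: "nat list"
  assumes "\<And>i. i < length x \<Longrightarrow> t ! i \<le> t ! (i + 1)"
    and "\<And>i. i < length x \<Longrightarrow> x ! i = map f [t ! i..<t ! (i + 1)]"
    and "t ! 0 = 0" and "j \<le> length x"
  shows "concat (take j x) = map f [0..<t ! j]"
  using assms(4)
proof (induction j)
  case 0
  then show ?case using assms(3) by simp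
next
  case (Suc j)
  then have "t ! j \<le> t ! Suc j" using assms(1)[of j] by simp
  then have "[0..<t ! Suc j] = [0..<t ! j] @ [t ! j..<t ! Suc j]"
    by (metis le0 le_add_diff_inverse upt_add_eq_append)
  then show ?case using Suc assms(2)[of j] by (simp add: take_Suc_conv_app_nth)
qed

lemma beta_shape:
  assumes m: "is_marked_array (x, P)" and w: "is_partitioned_walk (v, t, Q)"
    and r: "beta_rel (x, P) (v, t, Q)"
  shows "Q = P" "length t = length x + 1" "length v = length (concat x) + 1"
    "\<And>j. j \<le> length x \<Longrightarrow> t ! j = length (concat (take j x))"
    "\<And>k. k \<le> length (concat x) \<Longrightarrow> v ! k = sum_list (take k (concat x))"
proof -
  let ?f = "\<lambda>k. v ! (k + 1) - v ! k"
  have x: "length x > 0" using m by (auto simp: is_marked_array_def increment_array_def)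
  obtain n L where wk: "is_walk n v" "length t = L + 2" "t ! 0 = 0"
    "\<And>i. i \<le> L \<Longrightarrow> t ! i < t ! (i + 1)" "t ! (L + 1) = n"
    using w by (auto simp: is_partitioned_walk_def)
  have L: "L + 1 = length x" and "Q = P"
    and row: "\<And>i. i < length x \<Longrightarrow> x ! i = map ?f [t ! i..<t ! (i + 1)]"
    using r x wk(2) by (auto simp: beta_rel_def top_row_def top_index_def)
  show "Q = P" by fact
  show "length t = length x + 1" using L wk(2) by simp
  have *: "concat (take j x) = map ?f [0..<t ! j]" if "j \<le> length x" for j
    by (rule beta_concat[OF _ row wk(3) that]) (use wk(4) L in \<open>auto intro: less_imp_le\<close>)
  show "t ! j = length (concat (take j x))" if "j \<le> length x" for j
    using *[OF that] by (metis diff_zero length_map length_upt)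
  have c: "concat x = map ?f [0..<n]" using *[of "length x"] L wk(5) by simp
  then show "length v = length (concat x) + 1" using wk(1) by (simp add: is_walk_def)
  fix k assume "k \<le> length (concat x)"
  then have k: "k \<le> n" using c by simp
  have "v ! k = sum_list (map ?f [0..<k])"
    using wk(1) by (induction k) (auto simp: is_walk_def)
  also have "map ?f [0..<k] = take k (concat x)" using k c by (simp add: take_map)
  finally show "v ! k = sum_list (take k (concat x))" .
qed

lemma beta_ex1:
  assumes "is_marked_array m"
  shows "\<exists>!w. is_partitioned_walk w \<and> beta_rel m w"
proof -
  obtain x P where m: "m = (x, P)" by (cases m)
  have "w = w'" if "is_partitioned_walk w \<and> beta_rel (x, P) w"
    "is_partitioned_walk w' \<and> beta_rel (x, P) w'" for w w'
  proof -
    obtain v t Q v' t' Q' where e: "w = (v, t, Q)" "w' = (v', t', Q')" by (cases w; cases w')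
    note s = beta_shape[OF assms[unfolded m], of v t Q] beta_shape[OF assms[unfolded m], of v' t' Q']
    have "v = v'" "t = t'" "Q = Q'"
      using s that[unfolded e] by (auto intro!: nth_equalityI)
    then show ?thesis using e by simp
  qed
  then show ?thesis using beta_ex[OF assms[unfolded m]] unfolding m by blast
qed

lemma beta_spec:
  assumes "is_marked_array m"
  shows "is_partitioned_walk (beta m)" "beta_rel m (beta m)"
  using theI'[OF beta_ex1[OF assms]] unfolding beta_def by blast+

end

theory Submission
  imports Defs
begin

text \<open>
  Reading off increments inverts \<open>beta\<close> between all marked arrays and all partitioned walks,
  with \<open>T\<close>, \<open>S\<close> and the Bookends property preserved; so Crossings must be matched with Saw.
  Write \<open>u\<^sub>j\<close>, \<open>d\<^sub>j\<close> for the row counts. Since \<open>v(t\<^sub>j\<^sub>+\<^sub>1) - v(t\<^sub>j) = u\<^sub>j - d\<^sub>j\<close> and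
  \<open>t\<^sub>j\<^sub>+\<^sub>1 - t\<^sub>j = u\<^sub>j + d\<^sub>j\<close>, the Saw property at \<open>j\<close> says \<open>v(t\<^sub>j) = d\<^sub>j + M(j)\<close>, or
  equivalently \<open>v(t\<^sub>j\<^sub>+\<^sub>1) = u\<^sub>j + M(j)\<close>. Comparing two consecutive rows gives
  \<open>u\<^sub>i\<^sub>-\<^sub>1 - d\<^sub>i = M(i) - M(i - 1)\<close>, which is the Crossings property. At the two ends this needs
  \<open>M(-1) = 0\<close> and \<open>M(L + 1) = T - S\<close>, that is \<open>-1 \<le> S \<le> L + 1\<close>, which follows from
  \<open>d\<^sub>0, u\<^sub>L \<ge> 0\<close> and the fact that \<open>T = -1\<close> forces row \<open>0\<close> to end in \<open>-1\<close>.
\<close>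

section \<open>Counting the signs in a row\<close>

lemma sum_list_signs:
  fixes r :: "int list"
  assumes "set r \<subseteq> {1, -1}"
  shows "sum_list r = int (count_list r 1) - int (count_list r (-1))"
  using assms by (induction r) auto

lemma length_signs:
  fixes r :: "int list"
  assumes "set r \<subseteq> {1, -1}"
  shows "length r = count_list r 1 + count_list r (-1)"
  using assms by (induction r) auto

lemma row_ups_nonneg: "0 \<le> row_ups x i"
  by (simp add: row_ups_def)

lemma row_downs_nonneg: "0 \<le> row_downs x i"
  by (simp add: row_downs_def)

text \<open>Reindexing by naturals keeps every index within the guards of \<open>row_ups\<close> and
  \<open>row_downs\<close>, so each summand is the sum of one row.\<close>

lemma array_sigma_eq_sum_list:
  assumes "increment_array x"
  shows "array_sigma x = sum_list (concat x)"
proof -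
  have x: "x \<noteq> []" "\<And>r. r \<in> set x \<Longrightarrow> set r \<subseteq> {1, -1}"
    using assms by (auto simp: increment_array_def)
  have "{0..int (top_row x)} = int ` {..<length x}"
    using x(1) unfolding lessThan_atLeast0 image_int_atLeastLessThan
    by (cases x) (auto simp: top_row_def)
  then have "array_sigma x = (\<Sum>i<length x. row_ups x (int i) - row_downs x (int i))"
    unfolding array_sigma_def by (simp add: sum.reindex)
  also have "\<dots> = (\<Sum>i<length x. sum_list (x ! i))"
  proof (rule sum.cong)
    fix i assume "i \<in> {..<length x}"
    then show "row_ups x (int i) - row_downs x (int i) = sum_list (x ! i)"
      using x(2)[of "x ! i"] sum_list_signs[of "x ! i"]
      by (simp add: row_ups_def row_downs_def top_row_def)
  qed simp
  also have "\<dots> = sum_list (map sum_list x)"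
    by (simp add: sum_list_sum_nth lessThan_atLeast0)
  also have "\<dots> = sum_list (concat x)"
    by (induction x) auto
  finally show ?thesis .
qed

section \<open>A marked array and a walk related to it by \<open>beta_rel\<close>\<close>

context
  fixes x :: "int list list" and v :: "int list" and t :: "nat list" and P Q :: nat
  assumes marked: "is_marked_array (x, P)"
    and walk: "is_partitioned_walk (v, t, Q)"
    and rel: "beta_rel (x, P) (v, t, Q)"
begin

lemma rows: "x \<noteq> []" "\<And>i. i < length x \<Longrightarrow> x ! i \<noteq> []"
  "\<And>i. i < length x \<Longrightarrow> set (x ! i) \<subseteq> {1, -1}" "P < length x"
proof -
  have x: "x \<noteq> []" "\<And>r. r \<in> set x \<Longrightarrow> r \<noteq> [] \<and> set r \<subseteq> {1, -1}" "P \<le> length x - 1"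
    using marked by (auto simp: is_marked_array_def increment_array_def top_row_def)
  show "x \<noteq> []" by (fact x(1))
  show "x ! i \<noteq> []" "set (x ! i) \<subseteq> {1, -1}" if "i < length x" for i
    using x(2)[OF nth_mem[OF that]] by simp_all
  show "P < length x" using x(1,3) by (cases x) simp_all
qed

lemma top_index_eq: "top_index t = length x - 1"
  using rel by (simp add: beta_rel_def top_row_def)

lemma row_eq: "i < length x \<Longrightarrow> x ! i = map (\<lambda>k. v ! (k + 1) - v ! k) [t ! i..<t ! (i + 1)]"
  using rel by (auto simp: beta_rel_def top_row_def)

lemma t_step:
  assumes "i < length x"
  shows "int (t ! (i + 1)) = int (t ! i) + row_ups x (int i) + row_downs x (int i)"
proof -
  have "t ! (i + 1) = t ! i + length (x ! i)"
    using assms beta_shape(4)[OF marked walk rel] by (simp add: take_Suc_conv_app_nth)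
  then show ?thesis
    using assms length_signs[OF rows(3)[OF assms]]
    by (simp add: row_ups_def row_downs_def top_row_def)
qed

lemma t_less: "i < length x \<Longrightarrow> t ! i < t ! (i + 1)"
  using row_eq rows(2) by fastforce

lemma v_t:
  assumes "i \<le> length x"
  shows "v ! (t ! i) = sum_list (concat (take i x))"
proof -
  have c: "concat x = concat (take i x) @ concat (drop i x)"
    by (metis append_take_drop_id concat_append)
  have "t ! i \<le> length (concat x)"
    using beta_shape(4)[OF marked walk rel assms] by (subst c) simp
  then have "v ! (t ! i) = sum_list (take (t ! i) (concat x))"
    by (rule beta_shape(5)[OF marked walk rel])
  also have "take (t ! i) (concat x) = concat (take i x)"
    using beta_shape(4)[OF marked walk rel assms] by (subst c) simp
  finally show ?thesis .
qed

lemma v_step: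
  assumes "i < length x"
  shows "v ! (t ! (i + 1)) = v ! (t ! i) + row_ups x (int i) - row_downs x (int i)"
  using assms v_t[of i] v_t[of "i + 1"] sum_list_signs[OF rows(3)[OF assms]]
  by (simp add: take_Suc_conv_app_nth row_ups_def row_downs_def top_row_def)

text \<open>This carries \<T>, and with it \<S> and the Bookends property, from arrays to
  walks.\<close>

lemma last_row:
  assumes "i < length x"
  shows "last (x ! i) = walk_incr v (t ! (i + 1))"
  using t_less[OF assms] row_eq[OF assms] by (simp add: walk_incr_def last_map)

lemma last_row_sign:
  assumes "i < length x"
  shows "last (x ! i) \<in> {1, -1}"
  using rows(2,3)[OF assms] last_in_set by blast

lemma T_eq: "walk_T (v, t, Q) = array_T (x, P)"
  using last_row[OF rows(4)] beta_shape(1)[OF marked walk rel]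
  by (simp add: walk_T_def array_T_def walk_incr_def)

lemma v_end: "v ! (t ! length x) = array_sigma x"
  using v_t[of "length x"] array_sigma_eq_sum_list[of x] marked by (simp add: is_marked_array_def)

lemma S_eq: "walk_S (v, t, Q) = array_S (x, P)"
  using T_eq v_end rows(1) top_index_eq by (simp add: walk_S_def array_S_def)

lemma bookends_iff: "walk_bookends (v, t, Q) \<longleftrightarrow> array_bookends (x, P)"
proof -
  have "i < length x" if "i \<le> length x - 1" for i
    using that rows(1) by (cases x) auto
  then show ?thesis
    using T_eq last_row beta_shape(1)[OF marked walk rel]
    by (simp add: walk_bookends_def array_bookends_def top_index_eq top_row_def
        min.commute max.commute)
qed

section \<open>The Saw property against the Crossings property\<close>

lemma saw_iff_downs:
  "walk_saw (v, t, Q) \<longleftrightarrow>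
    (\<forall>j<length x. v ! (t ! j) = row_downs x (int j) + walk_M (v, t, Q) (int j))"
proof -
  have "{0..top_index t} = {..<length x}"
    using rows(1) by (cases x) (auto simp: top_index_eq)
  moreover have "v ! (t ! (j + 1)) + v ! (t ! j) =
        int (t ! (j + 1)) - int (t ! j) + 2 * walk_M (v, t, Q) (int j) \<longleftrightarrow>
      v ! (t ! j) = row_downs x (int j) + walk_M (v, t, Q) (int j)" if "j < length x" for j
    \<comment> \<open>The \<open>row_ups\<close> terms cancel, leaving twice the desired
      equation.\<close>
    unfolding t_step[OF that] v_step[OF that] by linarith
  ultimately show ?thesis
    by (auto simp: walk_saw_def)
qed

lemma crossings_iff_saw: "array_crossings (x, P) \<longleftrightarrow> walk_saw (v, t, Q)"
proof -
  define T S where "T = array_T (x, P)" and "S = array_S (x, P)"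
  define M where "M = (\<lambda>j. max (j - S) 0 - max (j - T) 0)"
  define L where "L = int (length x) - 1"
  have L: "int (length x) = L + 1" "0 \<le> L" "int (top_row x) = L"
    using rows(1) by (simp_all add: L_def top_row_def Suc_le_eq of_nat_diff)
  have M: "walk_M (v, t, Q) = M"
    by (simp add: walk_M_def M_def T_eq S_eq T_def S_def fun_eq_iff)
  \<comment> \<open>For an integer \<open>c\<close>, the positive part of \<open>i - c\<close> grows
    by 1 from \<open>i - 1\<close> to \<open>i\<close> exactly when \<open>i > c\<close>.\<close>
  have M_diff: "of_bool (i \<le> T) - of_bool (i \<le> S) = M i - M (i - 1)" for i
    by (simp add: M_def)
  have T_bounds: "-1 \<le> T" "T \<le> L + 1"
    using last_row_sign[OF rows(4)] rows(4) L by (auto simp: T_def array_T_def)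
  have T_down: "1 \<le> row_downs x 0" if "T = -1"
  proof -
    have "P = 0" and "last (x ! 0) = -1"
      using that last_row_sign[OF rows(4)] by (auto simp: T_def array_T_def)
    then have "-1 \<in> set (x ! 0)" using rows(2)[of 0] rows(4) last_in_set by force
    then have "count_list (x ! 0) (-1) \<noteq> 0" by (simp add: count_list_0_iff)
    then show ?thesis by (simp add: row_downs_def)
  qed
  have v0: "v ! (t ! 0) = 0" using v_t[of 0] by simp
  have v_end': "v ! (t ! length x) = T - S" using v_end by (simp add: T_def S_def array_S_def)
  have outside: "row_ups x (-1) = 0" "row_downs x (L + 1) = 0"
    using L by (simp_all add: row_ups_def row_downs_def)
  have crossings: "array_crossings (x, P) \<longleftrightarrow>
      (\<forall>i\<in>{0..L + 1}. row_ups x (i - 1) - row_downs x i = M i - M (i - 1))"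
    by (simp add: array_crossings_def L T_def[symmetric] S_def[symmetric] M_diff)
  have saw: "walk_saw (v, t, Q) \<longleftrightarrow>
      (\<forall>j<length x. v ! (t ! j) = row_downs x (int j) + M (int j))"
    by (simp add: saw_iff_downs M)
  show ?thesis
  proof
    assume "array_crossings (x, P)"
    then have cr: "row_ups x (i - 1) - row_downs x i = M i - M (i - 1)" if "0 \<le> i" "i \<le> L + 1" for i
      using crossings that by auto
    have "- row_downs x 0 = of_bool (0 \<le> T) - of_bool (0 \<le> S)"
      using cr[of 0] M_diff[of 0] outside(1) L by simp
    \<comment> \<open>If \<open>T \<ge> 0\<close>, a non-negative \<open>row_downs x 0\<close>
      forces \<open>S \<ge> 0\<close>; if \<open>T = -1\<close>, \<open>T_down\<close> makes it
      positive, which again forces \<open>S \<ge> 0\<close>.\<close>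
    then have "-1 \<le> S"
      using T_down T_bounds(1) row_downs_nonneg[of x 0] by (auto split: if_splits simp: of_bool_def)
    then have M_minus: "M (-1) = 0" using T_bounds(1) by (simp add: M_def)
    have "v ! (t ! j) = row_downs x (int j) + M (int j)" if "j < length x" for j
      using that
    proof (induction j)
      case 0
      then show ?case using cr[of 0] M_minus outside(1) v0 L by simp
    next
      case (Suc j)
      \<comment> \<open>Crossing row \<open>j\<close> turns \<open>row_downs x j + M j\<close> into
        \<open>row_ups x j + M j\<close>, which Crossings at \<open>j + 1\<close> rewrites.\<close>
      then show ?case using v_step[of j] cr[of "int j + 1"] L by (simp add: add.commute)
    qed
    then show "walk_saw (v, t, Q)" using saw by simp
  next
    assume "walk_saw (v, t, Q)"
    then have downs: "v ! (t ! j) = row_downs x (int j) + M (int j)" if "j < length x" for j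
      using saw that by simp
    then have ups: "v ! (t ! (j + 1)) = row_ups x (int j) + M (int j)" if "j < length x" for j
      using v_step that by simp
    show "array_crossings (x, P)"
      unfolding crossings
    proof
      fix i assume "i \<in> {0..L + 1}"
      then consider "i = 0" | "i = L + 1" | "1 \<le> i" "i \<le> L" by fastforce
      then show "row_ups x (i - 1) - row_downs x i = M i - M (i - 1)"
      proof cases
        case 1
        have "row_downs x 0 + M 0 = 0" using downs[of 0] v0 rows(1) by simp
        \<comment> \<open>Here \<open>M 0 \<le> 0\<close> and \<open>T \<ge> -1\<close> give
          \<open>S \<ge> -1\<close>, so both positive parts vanish at -1.\<close>
        moreover have "M (-1) = 0"
          using calculation row_downs_nonneg[of x 0] T_bounds(1) by (simp add: M_def)
        ultimately show ?thesis using 1 outside(1) by simp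
      next
        case 2
        have "row_ups x L + M L = T - S"
          using ups[of "length x - 1"] v_end' rows(1) L_def by (simp add: Suc_le_eq of_nat_diff)
        \<comment> \<open>From \<open>M L \<le> T - S\<close> and \<open>T \<le> L + 1\<close>
          follows \<open>S \<le> L + 1\<close>, so neither positive part truncates at
          \<open>L + 1\<close>.\<close>
        moreover have "M (L + 1) = T - S"
          using calculation row_ups_nonneg[of x L] T_bounds(2) by (simp add: M_def)
        ultimately show ?thesis using 2 outside(2) by simp
      next
        case 3
        define j where "j = nat (i - 1)"
        have j: "int j = i - 1" "int (j + 1) = i" "j + 1 < length x"
          using 3 L by (auto simp: j_def)
        show ?thesis using ups[of j] downs[of "j + 1"] j(3) unfolding j(1,2) by simp
      qed
    qed
  qed
qed

lemma valid_iff_quantile: "valid_marked_array (x, P) \<longleftrightarrow> quantile_partitioned_walk (v, t, Q)"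
  using marked walk bookends_iff crossings_iff_saw
  by (simp add: valid_marked_array_def quantile_partitioned_walk_def)

end

section \<open>Bijectivity of \<open>beta\<close>\<close>

lemma valid_marked_array_iff_beta:
  assumes "is_marked_array m"
  shows "valid_marked_array m \<longleftrightarrow> quantile_partitioned_walk (beta m)"
proof -
  obtain x P v t Q where e: "m = (x, P)" "beta m = (v, t, Q)"
    by (cases m; cases "beta m")
  show ?thesis
    using valid_iff_quantile[of x P v t Q] beta_spec[OF assms] assms e by simp
qed

lemma beta_rel_left_unique:
  assumes "is_marked_array m" "is_marked_array m'" "beta_rel m w" "beta_rel m' w"
  shows "m = m'"
proof -
  obtain x P x' P' v t Q where e: "m = (x, P)" "m' = (x', P')" "w = (v, t, Q)"
    by (cases m; cases m'; cases w)
  \<comment> \<open>\<open>top_row\<close> uses truncated subtraction, so it determines the length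
    only of a non-empty array.\<close>
  have "x \<noteq> []" "x' \<noteq> []"
    using assms(1,2) e by (auto simp: is_marked_array_def increment_array_def)
  moreover from this have "length x = length x'"
    using assms(3,4) e by (cases x; cases x') (auto simp: beta_rel_def top_row_def)
  ultimately have "x = x'"
    using assms(3,4) e by (intro nth_equalityI) (auto simp: beta_rel_def top_row_def)
  then show ?thesis using assms(3,4) e by (simp add: beta_rel_def)
qed

lemma bij_betw_beta: "bij_betw beta {m. is_marked_array m} {w. is_partitioned_walk w}"
proof (rule bij_betw_imageI)
  show "inj_on beta {m. is_marked_array m}"
  proof (rule inj_onI)
    fix m m' assume "m \<in> {m. is_marked_array m}" "m' \<in> {m. is_marked_array m}" "beta m = beta m'"
    then show "m = m'"
      using beta_rel_left_unique[of m m' "beta m"] beta_spec(2)[of m] beta_spec(2)[of m'] by simp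
  qed
  show "beta ` {m. is_marked_array m} = {w. is_partitioned_walk w}"
  proof (intro equalityI subsetI)
    fix w assume "w \<in> {w. is_partitioned_walk w}"
    then have w: "is_partitioned_walk w" by simp
    obtain v t P where e: "w = (v, t, P)" by (cases w)
    obtain n L where wk: "is_walk n v" "length t = L + 2"
      "\<And>i. i \<le> L \<Longrightarrow> t ! i < t ! (i + 1)" "t ! (L + 1) = n" "P \<le> L"
      using w by (auto simp: e is_partitioned_walk_def)
    \<comment> \<open>The preimage: the increments of \<open>v\<close>, cut at the times in
      \<open>t\<close>.\<close>
    define x where "x = map (\<lambda>i. map (\<lambda>k. v ! (k + 1) - v ! k) [t ! i..<t ! (i + 1)]) [0..<L + 1]"
    have top: "top_row x = L" by (simp add: x_def top_row_def)
    \<comment> \<open>Downward induction from the final time \<open>n\<close>; it ensures that the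
      rows of \<open>x\<close> read only genuine increments of the walk.\<close>
    have t_le: "t ! (i + 1) \<le> n" if "i \<le> L" for i
      using that
    proof (induction rule: inc_induct)
      case base
      then show ?case using wk(4) by simp
    next
      case (step i)
      then show ?case using wk(3)[of "Suc i"] by simp
    qed
    have "v ! (k + 1) - v ! k \<in> {1, -1}" if "k < n" for k
    proof -
      have "k + 1 \<in> {1..n}" using that by simp
      then show ?thesis using wk(1) unfolding is_walk_def by (metis add_diff_cancel_right')
    qed
    then have "set (map (\<lambda>k. v ! (k + 1) - v ! k) [t ! i..<t ! (i + 1)]) \<subseteq> {1, -1}"
      if "i \<le> L" for i
      using t_le[OF that] by (simp add: image_subset_iff)
    moreover have "[t ! i..<t ! (i + 1)] \<noteq> []" if "i \<le> L" for i
      using wk(3)[OF that] by simp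
    ultimately have "increment_array x"
      by (simp add: increment_array_def x_def less_Suc_eq_le del: upt_Suc)
    then have m: "is_marked_array (x, P)"
      using wk(5) by (simp add: is_marked_array_def top)
    moreover have "beta_rel (x, P) w"
      using wk(2) by (simp add: e beta_rel_def top top_index_def) (simp add: x_def del: upt_Suc)
    ultimately have "beta (x, P) = w"
      using w beta_ex1[OF m] beta_spec[OF m] by blast
    then show "w \<in> beta ` {m. is_marked_array m}"
      using m by blast
  qed (use beta_spec(1) in auto)
qed

theorem theorem5p8:
  shows "bij_betw beta {m. valid_marked_array m} {w. quantile_partitioned_walk w}"
proof (rule bij_betw_subset[OF bij_betw_beta])
  show "{m. valid_marked_array m} \<subseteq> {m. is_marked_array m}"
    by (auto simp: valid_marked_array_def)
  show "beta ` {m. valid_marked_array m} = {w. quantile_partitioned_walk w}"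
  proof (intro equalityI subsetI)
    fix w assume "w \<in> {w. quantile_partitioned_walk w}"
    then have w: "quantile_partitioned_walk w" by simp
    then have "w \<in> beta ` {m. is_marked_array m}"
      using bij_betw_imp_surj_on[OF bij_betw_beta] by (simp add: quantile_partitioned_walk_def)
    then obtain m where "is_marked_array m" "w = beta m" by blast
    then show "w \<in> beta ` {m. valid_marked_array m}"
      using w valid_marked_array_iff_beta by blast
  next
    fix w assume "w \<in> beta ` {m. valid_marked_array m}"
    then show "w \<in> {w. quantile_partitioned_walk w}"
      using valid_marked_array_iff_beta valid_marked_array_def by blast
  qed
qed

end
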